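(* Let $n\in\mathbb{N}$ and let $A:\mathbb{R}[x_1,\dots,x_n]\to\mathbb{R}[x_1,\dots,x_n]$ be linear. Then the following are equivalent: (i) $A\in\mathfrak{g}$. (ii) $\sup_{k\in\mathbb{N}_0}\deg A^kx^\alpha<\infty$ for all $\alpha\in\mathbb{N}_0^n$. (iii) $\sup_{k\in\mathbb{N}_0}\deg A^kp<\infty$ for all $p\in\mathbb{R}[x_1,\dots,x_n]$. (iv) For all $i\in\mathbb{N}_0$ there exist linear subspaces $V_i\subseteq\mathbb{R}[x_1,\dots,x_n]$ with (a) $\dim V_i<\infty$ for all $i\in\mathbb{N}_0$, (b) $\bigcup_{i\in\mathbb{N}_0}V_i=\mathbb{R}[x_1,\dots,x_n]$, and (c) $AV_i\subseteq V_i$ for all $i\in\mathbb{N}_0$.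
   Context: $\mathbb{N}=\{1,2,\dots\}$, $\mathbb{N}_0=\{0,1,2,\dots\}$. Fix $\varepsilon>0$. $\mathfrak{g}$ is the set of all linear $A:\mathbb{R}[x_1,\dots,x_n]\to\mathbb{R}[x_1,\dots,x_n]$ such that $e^{tA}$ is a map $\mathbb{R}[x_1,\dots,x_n]\to\mathbb{R}[x_1,\dots,x_n]$ for all $t\in[0,\varepsilon)$, i.e. for every $p\in\mathbb{R}[x_1,\dots,x_n]$ and $t\in[0,\varepsilon)$ the series $e^{tA}p=\sum_{k\in\mathbb{N}_0}\frac{t^k}{k!}A^kp$ converges in $\mathbb{R}[x_1,\dots,x_n]$. Here $\mathbb{R}[x_1,\dots,x_n]$ carries the LF-topology of $\bigcup_d\mathbb{R}[x_1,\dots,x_n]_{\leq d}$: a sequence $(p_i)$ converges to $p$ iff there is $D\in\mathbb{N}_0$ with $\deg p_i\leq D$ for all $i$ and $p_i\to p$ in the finite dimensional space $\mathbb{R}[x_1,\dots,x_n]_{\leq D}$. The degree of the zero polynomial is taken to be $-\infty$ (or $0$). *)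

theory Defs
  imports "HOL-Analysis.Analysis" "HOL-Analysis.Finite_Function_Topology"
begin

text \<open>Real polynomials in finitely many variables indexed by \<open>'n\<close> (so \<open>n = CARD('n)\<close>):
  finitely supported maps from exponent vectors to coefficients. The vector space structure
  and the norm (the sum of the absolute values of the coefficients) are those of
  \<^theory>\<open>HOL-Analysis.Finite_Function_Topology\<close>.\<close>

type_synonym 'n mpoly = "('n \<Rightarrow>\<^sub>0 nat) \<Rightarrow>\<^sub>0 real"

abbreviation monomial :: "('n::finite \<Rightarrow>\<^sub>0 nat) \<Rightarrow> 'n mpoly" where
  "monomial \<alpha> \<equiv> Poly_Mapping.single \<alpha> 1"

definition exponent_degree :: "('n::finite \<Rightarrow>\<^sub>0 nat) \<Rightarrow> nat" where
  "exponent_degree \<alpha> = (\<Sum>i\<in>UNIV. Poly_Mapping.lookup \<alpha> i)"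

text \<open>The zero polynomial has degree 0 here.\<close>

definition total_degree :: "'n::finite mpoly \<Rightarrow> nat" where
  "total_degree p = Max (insert 0 (exponent_degree ` Poly_Mapping.keys p))"

definition polys_upto :: "nat \<Rightarrow> 'n::finite mpoly set" where
  "polys_upto D = {p. total_degree p \<le> D}"

text \<open>Sequential convergence in the LF-topology. The norm topology on the whole polynomial space
  is coarser than the LF-topology, so the arrow is used only inside one of the finite-dimensional
  spaces \<^term>\<open>polys_upto D\<close>, where it is the unique Hausdorff vector space topology.\<close>

definition LF_tendsto :: "(nat \<Rightarrow> 'n::finite mpoly) \<Rightarrow> 'n mpoly \<Rightarrow> bool" where
  "LF_tendsto X p \<longleftrightarrow>
     (\<exists>D. (\<forall>i. X i \<in> polys_upto D) \<and> p \<in> polys_upto D \<and> X \<longlonglongrightarrow> p)"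

definition LF_summable :: "(nat \<Rightarrow> 'n::finite mpoly) \<Rightarrow> bool" where
  "LF_summable f \<longleftrightarrow> (\<exists>p. LF_tendsto (\<lambda>N. \<Sum>k<N. f k) p)"

definition exp_generators :: "real \<Rightarrow> ('n::finite mpoly \<Rightarrow> 'n mpoly) set" where
  "exp_generators \<epsilon> =
     {A. linear A \<and>
         (\<forall>t\<in>{0..<\<epsilon>}. \<forall>p. LF_summable (\<lambda>k. (t ^ k / fact k) *\<^sub>R (A ^^ k) p))}"

definition finite_dimensional :: "'a::real_vector set \<Rightarrow> bool" where
  "finite_dimensional V \<longleftrightarrow> (\<exists>B. finite B \<and> independent B \<and> span B = V)"

end

theory Submission
  imports Defs
begin

text \<open>If \<open>e\<^sup>t\<^sup>Ap\<close> converges for one \<open>t > 0\<close>, the partial sums have bounded degree, hence so do their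
  differences, which are nonzero multiples of \<open>A\<^sup>kp\<close>. If the degrees along the orbits of the monomials
  are bounded, the spans of finitely many such orbits are finite-dimensional, invariant, and
  exhaust the polynomials. Finally, on a finite-dimensional invariant space the coordinates
  of \<open>A\<^sup>kp\<close> grow at most geometrically in \<open>k\<close>, so the exponential series converges coordinatewise.\<close>

text \<open>Suprema are taken in \<open>enat\<close> because a supremum in \<open>nat\<close>
  carries no information for unbounded sets; the proofs work with the bound
  \<open>D\<close>.\<close>

lemma SUP_enat_less_infinity_iff:
  "(SUP k. enat (f k)) < \<infinity> \<longleftrightarrow> (\<exists>D. \<forall>k. f k \<le> D)"
proof
  assume "(SUP k. enat (f k)) < \<infinity>"
  then obtain D where D: "(SUP k. enat (f k)) = enat D"
    by (rule less_infinityE)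
  have "enat (f k) \<le> enat D" for k
    unfolding D[symmetric] by (rule SUP_upper) simp
  then show "\<exists>D. \<forall>k. f k \<le> D" by auto
next
  assume "\<exists>D. \<forall>k. f k \<le> D"
  then obtain D where "\<And>k. f k \<le> D" by blast
  then have "(SUP k. enat (f k)) \<le> enat D"
    by (intro SUP_least) simp
  then show "(SUP k. enat (f k)) < \<infinity>"
    using enat_ord_simps(4) order_le_less_trans by blast
qed

text \<open>A basis of \<open>V\<close> is an independent subset of \<open>span F\<close>, hence has
  at most \<open>card F\<close> elements.\<close>

lemma finite_dimensional_subset_span:
  assumes "subspace V" "finite F" "V \<subseteq> span F"
  shows "finite_dimensional V"
proof -
  obtain B where B: "B \<subseteq> V" "independent B" "V \<subseteq> span B"
    using real_vector.basis_exists[of V] by metis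
  have "finite B"
    using real_vector.independent_span_bound[OF assms(2) B(2)] B(1) assms(3) by blast
  moreover have "span B = V"
    using B assms(1) by (intro span_subspace)
  ultimately show ?thesis
    using B(2) by (auto simp: finite_dimensional_def)
qed

section \<open>Polynomials of bounded degree\<close>

lemma mem_polys_upto_iff:
  "p \<in> polys_upto D \<longleftrightarrow> (\<forall>\<alpha>\<in>Poly_Mapping.keys p. exponent_degree \<alpha> \<le> D)"
  by (simp add: polys_upto_def total_degree_def)

lemma polys_upto_mono: "D \<le> E \<Longrightarrow> polys_upto D \<subseteq> polys_upto E"
  by (auto simp: polys_upto_def)

lemma lookup_scaleR:
  "Poly_Mapping.lookup (c *\<^sub>R p) \<alpha> = c *\<^sub>R Poly_Mapping.lookup p \<alpha>"
proof -
  \<comment> \<open>\<open>scaleR\<close> is defined through the abstraction function, so finite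
    support must be known before coefficients can be read off.\<close>
  have "finite {\<alpha>. c *\<^sub>R Poly_Mapping.lookup p \<alpha> \<noteq> 0}"
    by (rule finite_subset[OF _ finite_keys[of p]]) (auto simp: in_keys_iff)
  then show ?thesis
    by (simp add: scaleR_poly_mapping_def)
qed

lemma subspace_polys_upto: "subspace (polys_upto D :: 'n::finite mpoly set)"
proof (rule subspaceI)
  show "(0 :: 'n mpoly) \<in> polys_upto D" by (simp add: mem_polys_upto_iff)
next
  fix p q :: "'n mpoly" assume "p \<in> polys_upto D" "q \<in> polys_upto D"
  then show "p + q \<in> polys_upto D"
    using keys_add[of p q] by (auto simp: mem_polys_upto_iff)
next
  fix c and p :: "'n mpoly" assume "p \<in> polys_upto D"
  then show "c *\<^sub>R p \<in> polys_upto D"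
    by (auto simp: mem_polys_upto_iff in_keys_iff lookup_scaleR)
qed

text \<open>Every coordinate is at most the degree, so these vectors embed into the finite box of
  functions from the variables to \<open>{..D}\<close>.\<close>

lemma finite_exponent_degree_le:
  "finite {\<alpha> :: 'n::finite \<Rightarrow>\<^sub>0 nat. exponent_degree \<alpha> \<le> D}"
proof (rule finite_imageD)
  have "Poly_Mapping.lookup \<alpha> i \<le> exponent_degree \<alpha>" for \<alpha> :: "'n \<Rightarrow>\<^sub>0 nat" and i
    unfolding exponent_degree_def by (rule member_le_sum) auto
  then have "Poly_Mapping.lookup ` {\<alpha> :: 'n \<Rightarrow>\<^sub>0 nat. exponent_degree \<alpha> \<le> D}
      \<subseteq> (\<Pi>\<^sub>E i\<in>UNIV. {..D})"
    by (auto intro: order_trans)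
  then show "finite (Poly_Mapping.lookup ` {\<alpha> :: 'n \<Rightarrow>\<^sub>0 nat. exponent_degree \<alpha> \<le> D})"
    by (rule finite_subset) (simp add: finite_PiE)
  show "inj_on Poly_Mapping.lookup {\<alpha> :: 'n \<Rightarrow>\<^sub>0 nat. exponent_degree \<alpha> \<le> D}"
    by (simp add: inj_on_def lookup_inject)
qed

lemma poly_eq_sum_monomials:
  "p = (\<Sum>\<alpha>\<in>Poly_Mapping.keys p. Poly_Mapping.lookup p \<alpha> *\<^sub>R monomial \<alpha>)"
proof (rule poly_mapping_eqI)
  fix \<beta>
  have "Poly_Mapping.lookup (\<Sum>\<alpha>\<in>Poly_Mapping.keys p. Poly_Mapping.lookup p \<alpha> *\<^sub>R monomial \<alpha>) \<beta>
      = (\<Sum>\<alpha>\<in>Poly_Mapping.keys p. if \<alpha> = \<beta> then Poly_Mapping.lookup p \<alpha> else 0)"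
    unfolding lookup_sum by (intro sum.cong refl) (simp add: lookup_scaleR lookup_single when_def)
  also have "\<dots> = Poly_Mapping.lookup p \<beta>"
    by (simp add: in_keys_iff)
  finally show "Poly_Mapping.lookup p \<beta> = Poly_Mapping.lookup
      (\<Sum>\<alpha>\<in>Poly_Mapping.keys p. Poly_Mapping.lookup p \<alpha> *\<^sub>R monomial \<alpha>) \<beta>" by simp
qed

lemma polys_upto_subset_span:
  "polys_upto D \<subseteq> span (monomial ` {\<alpha>. exponent_degree \<alpha> \<le> D})"
proof
  fix p :: "'a::finite mpoly" assume "p \<in> polys_upto D"
  then have "(\<Sum>\<alpha>\<in>Poly_Mapping.keys p. Poly_Mapping.lookup p \<alpha> *\<^sub>R monomial \<alpha>)
      \<in> span (monomial ` {\<alpha>. exponent_degree \<alpha> \<le> D})"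
    by (intro span_sum span_scale span_base) (auto simp: mem_polys_upto_iff)
  then show "p \<in> span (monomial ` {\<alpha>. exponent_degree \<alpha> \<le> D})"
    using poly_eq_sum_monomials[of p] by simp
qed

lemma finite_dimensional_subset_polys_upto:
  assumes "subspace V" "V \<subseteq> polys_upto D"
  shows "finite_dimensional V"
  using assms finite_dimensional_subset_span[of V "monomial ` {\<alpha>. exponent_degree \<alpha> \<le> D}"]
    polys_upto_subset_span finite_exponent_degree_le by blast

lemma finite_subset_polys_upto:
  assumes "finite B"
  obtains D where "B \<subseteq> polys_upto D"
proof
  \<comment> \<open>The sum of the degrees dominates each of them and is also meaningful for empty
    \<open>B\<close>.\<close>
  show "B \<subseteq> polys_upto (\<Sum>b\<in>B. total_degree b)"
    using assms by (auto simp: polys_upto_def intro: member_le_sum)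
qed

section \<open>The exponential series on an invariant subspace\<close>

text \<open>A matrix \<open>M\<close> represents \<open>A\<close> on the generators, so the
  coefficient vectors of the orbit arise by repeated multiplication with \<open>M\<close>, each of
  which enlarges the l1 norm by at most a fixed factor.\<close>

lemma orbit_coefficients_geometric:
  fixes A :: "'a::real_vector \<Rightarrow> 'a"
  assumes "linear A" "finite B" "A ` B \<subseteq> span B" "p \<in> span B"
  obtains c K C where "\<And>k. (A ^^ k) p = (\<Sum>b\<in>B. c k b *\<^sub>R b)"
    and "\<And>k b. b \<in> B \<Longrightarrow> \<bar>c k b\<bar> \<le> K * C ^ k"
proof -
  have "\<forall>b'\<in>B. \<exists>u. A b' = (\<Sum>b\<in>B. u b *\<^sub>R b)"
    using assms(2,3) by (fastforce simp: span_finite)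
  then obtain M where M: "\<And>b'. b' \<in> B \<Longrightarrow> A b' = (\<Sum>b\<in>B. M b' b *\<^sub>R b)"
    by metis
  obtain u where u: "p = (\<Sum>b\<in>B. u b *\<^sub>R b)"
    using assms(2,4) by (auto simp: span_finite)
  define c where "c = rec_nat u (\<lambda>_ v b. \<Sum>b'\<in>B. v b' * M b' b)"
  have c0: "c 0 = u" and cS: "c (Suc k) b = (\<Sum>b'\<in>B. c k b' * M b' b)" for k b
    by (simp_all add: c_def)
  \<comment> \<open>The sum of all absolute entries of \<open>M\<close> is a crude bound for its l1
    operator norm; \<open>K\<close> is the l1 norm of the initial vector.\<close>
  define C where "C = (\<Sum>b\<in>B. \<Sum>b'\<in>B. \<bar>M b' b\<bar>)"
  define K where "K = (\<Sum>b\<in>B. \<bar>u b\<bar>)"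
  have "(A ^^ k) p = (\<Sum>b\<in>B. c k b *\<^sub>R b)" for k
  proof (induction k)
    case 0
    then show ?case using u by (simp add: c0)
  next
    case (Suc k)
    have "(A ^^ Suc k) p = A (\<Sum>b'\<in>B. c k b' *\<^sub>R b')"
      using Suc by simp
    also have "\<dots> = (\<Sum>b'\<in>B. c k b' *\<^sub>R A b')"
      by (simp add: linear_sum[OF assms(1)] linear_scale[OF assms(1)])
    also have "\<dots> = (\<Sum>b'\<in>B. \<Sum>b\<in>B. (c k b' * M b' b) *\<^sub>R b)"
      by (intro sum.cong refl) (simp add: M scaleR_sum_right)
    also have "\<dots> = (\<Sum>b\<in>B. c (Suc k) b *\<^sub>R b)"
      by (subst sum.swap) (simp add: cS scaleR_sum_left)
    finally show ?case .
  qed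
  \<comment> \<open>The induction runs on the whole l1 norm, since each new coefficient mixes all
    the old ones.\<close>
  moreover have sum_le: "(\<Sum>b\<in>B. \<bar>c k b\<bar>) \<le> K * C ^ k" for k
  proof (induction k)
    case 0
    then show ?case by (simp add: c0 K_def)
  next
    case (Suc k)
    have C0: "C \<ge> 0" by (simp add: C_def sum_nonneg)
    have "(\<Sum>b\<in>B. \<bar>c (Suc k) b\<bar>) \<le> (\<Sum>b\<in>B. \<Sum>b'\<in>B. \<bar>c k b'\<bar> * \<bar>M b' b\<bar>)"
      unfolding cS abs_mult[symmetric] by (intro sum_mono sum_abs)
    also have "\<dots> \<le> (\<Sum>b\<in>B. \<Sum>b'\<in>B. (\<Sum>b\<in>B. \<bar>c k b\<bar>) * \<bar>M b' b\<bar>)"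
      using assms(2) by (intro sum_mono mult_right_mono member_le_sum) auto
    also have "\<dots> = (\<Sum>b\<in>B. \<bar>c k b\<bar>) * C"
      by (simp add: C_def sum_distrib_left)
    also have "\<dots> \<le> K * C ^ Suc k"
      using mult_right_mono[OF Suc C0] by (simp add: mult_ac)
    finally show ?case .
  qed
  have "\<bar>c k b\<bar> \<le> K * C ^ k" if "b \<in> B" for k b
    using sum_le[of k] member_le_sum[OF that, of "\<lambda>b. \<bar>c k b\<bar>"] assms(2) by simp
  ultimately show thesis by (rule that)
qed

text \<open>Grouping by basis vectors leaves finitely many real series, each dominated by
  \<open>K\<close> times the exponential series at \<open>\<bar>t\<bar> * C\<close>.\<close>

lemma LF_summable_exp_if_invariant:
  fixes A :: "'n::finite mpoly \<Rightarrow> 'n mpoly"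
  assumes "linear A" "finite_dimensional V" "A ` V \<subseteq> V" "p \<in> V"
  shows "LF_summable (\<lambda>k. (t ^ k / fact k) *\<^sub>R (A ^^ k) p)"
proof -
  obtain B where B: "finite B" "span B = V"
    using assms(2) by (auto simp: finite_dimensional_def)
  have "A ` B \<subseteq> span B" "p \<in> span B"
    using assms(3,4) B(2) span_superset[of B] by blast+
  then obtain c K C where c: "\<And>k. (A ^^ k) p = (\<Sum>b\<in>B. c k b *\<^sub>R b)"
    and bound: "\<And>k b. b \<in> B \<Longrightarrow> \<bar>c k b\<bar> \<le> K * C ^ k"
    by (rule orbit_coefficients_geometric[OF assms(1) B(1)]) (rule that)
  have summable: "summable (\<lambda>k. t ^ k / fact k * c k b)" if "b \<in> B" for b
  proof (rule summable_comparison_test')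
    show "summable (\<lambda>k. K * ((\<bar>t\<bar> * C) ^ k /\<^sub>R fact k))"
      by (intro summable_mult summable_exp_generic)
    show "norm (t ^ k / fact k * c k b) \<le> K * ((\<bar>t\<bar> * C) ^ k /\<^sub>R fact k)" if "k \<ge> 0" for k
      using mult_left_mono[OF bound[OF \<open>b \<in> B\<close>, of k], of "\<bar>t\<bar> ^ k / fact k"]
      by (simp add: abs_mult power_abs power_mult_distrib field_simps)
  qed
  have partial: "(\<Sum>k<N. (t ^ k / fact k) *\<^sub>R (A ^^ k) p)
      = (\<Sum>b\<in>B. (\<Sum>k<N. t ^ k / fact k * c k b) *\<^sub>R b)" for N
    unfolding c by (simp add: scaleR_sum_right scaleR_sum_left) (rule sum.swap)
  \<comment> \<open>The common degree bound for the LF-topology: partial sums and limit are all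
    combinations of \<open>B\<close>.\<close>
  obtain D where "B \<subseteq> polys_upto D"
    using finite_subset_polys_upto[OF B(1)] by blast
  then have comb: "(\<Sum>b\<in>B. d b *\<^sub>R b) \<in> polys_upto D" for d
    by (intro subspace_sum subspace_scale subspace_polys_upto) auto
  have "(\<lambda>N. \<Sum>b\<in>B. (\<Sum>k<N. t ^ k / fact k * c k b) *\<^sub>R b)
      \<longlonglongrightarrow> (\<Sum>b\<in>B. suminf (\<lambda>k. t ^ k / fact k * c k b) *\<^sub>R b)"
    by (intro tendsto_sum tendsto_scaleR tendsto_const summable_LIMSEQ summable)
  then show ?thesis
    unfolding LF_summable_def LF_tendsto_def partial by (intro exI[of _ D] exI conjI allI) (rule comb)+
qed

section \<open>Degree bounds along orbits\<close>

lemma bounded_degree_if_LF_summable: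
  assumes "LF_summable (\<lambda>k. a k *\<^sub>R q k)" "\<And>k. a k \<noteq> 0"
  obtains D where "\<And>k. q k \<in> polys_upto D"
proof -
  obtain D where D: "\<And>N. (\<Sum>k<N. a k *\<^sub>R q k) \<in> polys_upto D"
    using assms(1) by (auto simp: LF_summable_def LF_tendsto_def)
  have "q k \<in> polys_upto D" for k
  proof -
    \<comment> \<open>The term is the difference of the partial sums with \<open>Suc k\<close> and
      \<open>k\<close> terms.\<close>
    have "a k *\<^sub>R q k \<in> polys_upto D"
      using subspace_diff[OF subspace_polys_upto D D, of "Suc k" k] by simp
    from subspace_scale[OF subspace_polys_upto this, of "inverse (a k)"]
    show ?thesis using assms(2) by simp
  qed
  then show thesis by (rule that)
qed

lemma invariant_exhaustion_if_bounded_degree: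
  fixes A :: "'n::finite mpoly \<Rightarrow> 'n mpoly"
  assumes "linear A" "\<And>\<alpha>. \<exists>D. \<forall>k. (A ^^ k) (monomial \<alpha>) \<in> polys_upto D"
  obtains V :: "nat \<Rightarrow> 'n mpoly set"
  where "\<And>i. subspace (V i)" "\<And>i. finite_dimensional (V i)" "(\<Union>i. V i) = UNIV"
    "\<And>i. A ` V i \<subseteq> V i"
proof -
  obtain D where D: "\<And>\<alpha> k. (A ^^ k) (monomial \<alpha>) \<in> polys_upto (D \<alpha>)"
    using assms(2) by metis
  \<comment> \<open>\<open>G i\<close> may be infinite; its span is finite-dimensional because only
    finitely many orbits, each of bounded degree, enter.\<close>
  define G where "G i = {(A ^^ k) (monomial \<alpha>) | k \<alpha>. exponent_degree \<alpha> \<le> i}" for i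
  have "finite_dimensional (span (G i))" for i
  proof (rule finite_dimensional_subset_polys_upto)
    let ?E = "\<Sum>\<alpha> | exponent_degree \<alpha> \<le> i. D \<alpha>"
    have "D \<alpha> \<le> ?E" if "exponent_degree \<alpha> \<le> i" for \<alpha>
      using that finite_exponent_degree_le by (intro member_le_sum) auto
    then have "G i \<subseteq> polys_upto ?E"
      using D polys_upto_mono unfolding G_def by blast
    then show "span (G i) \<subseteq> polys_upto ?E"
      by (intro span_minimal subspace_polys_upto)
  qed (rule subspace_span)
  moreover have "(\<Union>i. span (G i)) = UNIV"
  proof -
    have "p \<in> span (G (total_degree p))" for p
    proof -
      \<comment> \<open>The case \<open>k = 0\<close> puts the monomials themselves into
        \<open>G\<close>.\<close>
      have "monomial ` {\<alpha>. exponent_degree \<alpha> \<le> total_degree p} \<subseteq> G (total_degree p)"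
        unfolding G_def by (force intro: exI[of _ 0])
      moreover have "p \<in> polys_upto (total_degree p)"
        by (simp add: polys_upto_def)
      ultimately show ?thesis
        using polys_upto_subset_span span_mono by blast
    qed
    then show ?thesis by blast
  qed
  moreover have "A ` span (G i) \<subseteq> span (G i)" for i
  proof -
    have "A ((A ^^ k) q) = (A ^^ Suc k) q" for k q by simp
    then have "A ` G i \<subseteq> G i"
      unfolding G_def by blast
    then show ?thesis
      unfolding linear_span_image[OF assms(1), symmetric] by (rule span_mono)
  qed
  ultimately show thesis by (intro that[of "\<lambda>i. span (G i)"] subspace_span)
qed

theorem theorem3p3:
  fixes A :: "'n::finite mpoly \<Rightarrow> 'n mpoly" and \<epsilon> :: real
  assumes "\<epsilon> > 0" and "linear A"
  shows "(A \<in> exp_generators \<epsilon> \<longleftrightarrow>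
            (\<forall>\<alpha>. (SUP k. enat (total_degree ((A ^^ k) (monomial \<alpha>)))) < \<infinity>)) \<and>
         (A \<in> exp_generators \<epsilon> \<longleftrightarrow>
            (\<forall>p. (SUP k. enat (total_degree ((A ^^ k) p))) < \<infinity>)) \<and>
         (A \<in> exp_generators \<epsilon> \<longleftrightarrow>
            (\<exists>V :: nat \<Rightarrow> 'n mpoly set.
               (\<forall>i. subspace (V i)) \<and>
               (\<forall>i. finite_dimensional (V i)) \<and>
               (\<Union>i. V i) = UNIV \<and>
               (\<forall>i. A ` V i \<subseteq> V i)))"
proof -
  let ?i = "A \<in> exp_generators \<epsilon>"
  let ?ii = "\<forall>\<alpha>. (SUP k. enat (total_degree ((A ^^ k) (monomial \<alpha>)))) < \<infinity>"
  let ?iii = "\<forall>p. (SUP k. enat (total_degree ((A ^^ k) p))) < \<infinity>"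
  let ?iv = "\<exists>V :: nat \<Rightarrow> 'n mpoly set. (\<forall>i. subspace (V i)) \<and>
    (\<forall>i. finite_dimensional (V i)) \<and> (\<Union>i. V i) = UNIV \<and> (\<forall>i. A ` V i \<subseteq> V i)"
  \<comment> \<open>The implications form the cycle (i), (iii), (ii), (iv), (i).\<close>
  have "?i \<Longrightarrow> ?iii"
  proof
    \<comment> \<open>At \<open>t = 0\<close> all coefficients with \<open>k > 0\<close> vanish, so
      a point strictly inside the interval is chosen.\<close>
    fix p assume ?i
    then have "LF_summable (\<lambda>k. ((\<epsilon> / 2) ^ k / fact k) *\<^sub>R (A ^^ k) p)"
      using \<open>\<epsilon> > 0\<close> unfolding exp_generators_def by simp
    then obtain D where "\<And>k. (A ^^ k) p \<in> polys_upto D"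
      by (rule bounded_degree_if_LF_summable) (use \<open>\<epsilon> > 0\<close> in auto)
    then show "(SUP k. enat (total_degree ((A ^^ k) p))) < \<infinity>"
      unfolding SUP_enat_less_infinity_iff polys_upto_def by blast
  qed
  moreover have "?iii \<Longrightarrow> ?ii" by blast
  moreover have "?ii \<Longrightarrow> ?iv"
  proof -
    assume ?ii
    then have "\<And>\<alpha>. \<exists>D. \<forall>k. (A ^^ k) (monomial \<alpha>) \<in> polys_upto D"
      unfolding SUP_enat_less_infinity_iff polys_upto_def by blast
    from invariant_exhaustion_if_bounded_degree[OF \<open>linear A\<close> this]
    show ?iv by metis
  qed
  moreover have "?iv \<Longrightarrow> ?i"
  proof -
    assume ?iv
    then obtain V :: "nat \<Rightarrow> 'n mpoly set" where V: "\<And>i. finite_dimensional (V i)"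
      "(\<Union>i. V i) = UNIV" "\<And>i. A ` V i \<subseteq> V i" by blast
    \<comment> \<open>Convergence is obtained for every real \<open>t\<close>, in particular on the
      required interval.\<close>
    have "LF_summable (\<lambda>k. (t ^ k / fact k) *\<^sub>R (A ^^ k) p)" for t p
    proof -
      obtain i where "p \<in> V i" using V(2) by blast
      then show ?thesis
        using LF_summable_exp_if_invariant \<open>linear A\<close> V(1,3) by blast
    qed
    then show ?i
      using \<open>linear A\<close> by (simp add: exp_generators_def)
  qed
  ultimately show ?thesis by blast
qed

end
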